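(* Let $\mathcal{V}$ be a finite vocabulary, $L\ge 1$, $x$ a fixed prompt, and let $\pi_\theta(y\mid x)=\prod_{n=0}^{L-1}\pi_\theta(y_n\mid h_n)$ and $\pi_{\mathrm{ref}}(y\mid x)=\prod_{n=0}^{L-1}\pi_{\mathrm{ref}}(y_n\mid h_n)$ be autoregressive distributions over $y=(y_0,\dots,y_{L-1})\in\mathcal{V}^L$, where $h_n=(x,y_0,\dots,y_{n-1})$; all conditional probabilities are positive, those of $\pi_\theta$ are differentiable in $\theta\in\mathbb{R}^d$, and $\pi_{\mathrm{ref}}$ does not depend on $\theta$. Let $$\rho_n=\log\frac{\pi_\theta(y_n\mid h_n)}{\pi_{\mathrm{ref}}(y_n\mid h_n)},\qquad \omega_n=\nabla_\theta\log\pi_\theta(y_n\mid h_n).$$ Then the sequence-level KL gradient satisfies $$\nabla_\theta\,\mathrm{KL}\big(\pi_\theta(\cdot\mid x)\,\|\,\pi_{\mathrm{ref}}(\cdot\mid x)\big)=\mathbb{E}_{y\sim\pi_\theta(\cdot\mid x)}\Big[\sum_{n=0}^{L-1}\Big(\sum_{m=n}^{L-1}\rho_m\Big)\omega_n\Big],$$ while the token-level KL gradient satisfies $$\mathbb{E}_{y\sim\pi_\theta(\cdot\mid x)}\Big[\sum_{n=0}^{L-1}\nabla_\theta\,\mathrm{KL}\big(\pi_\theta(\cdot\mid h_n)\,\|\,\pi_{\mathrm{ref}}(\cdot\mid h_n)\big)\Big]=\mathbb{E}_{y\sim\pi_\theta(\cdot\mid x)}\Big[\sum_{n=0}^{L-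1}\rho_n\,\omega_n\Big].$$
   Context: $\mathrm{KL}(P\|Q)=\sum_a P(a)\log\frac{P(a)}{Q(a)}$ for distributions on a finite set. In the token-level quantity, each per-position KL $\mathrm{KL}(\pi_\theta(\cdot\mid h_n)\|\pi_{\mathrm{ref}}(\cdot\mid h_n))$ is the KL between next-token distributions at a fixed prefix $h_n$; its gradient in $\theta$ is taken with $h_n$ held fixed, and then averaged over prefixes drawn from $\pi_\theta$ (the outer expectation is not differentiated). *)

theory Defs
  imports "HOL-Probability.Probability"
begin

definition grad :: "('a::real_inner \<Rightarrow> real) \<Rightarrow> 'a \<Rightarrow> 'a" where
  "grad f x = (THE D. GDERIV f x :> D)"

lemma grad_eqI:
  assumes "GDERIV f x :> D"
  shows "grad f x = D"
  unfolding grad_def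
proof (rule the_equality)
  fix E assume "GDERIV f x :> E"
  with assms have "(\<lambda>h. inner h E) = (\<lambda>h. inner h D)"
    unfolding gderiv_def by (rule has_derivative_unique[rotated])
  then have "inner (E - D) (E - D) = 0"
    by (metis inner_diff_right right_minus_eq)
  then show "E = D" by simp
qed (rule assms)

lemma GDERIV_grad:
  fixes f :: "'a::euclidean_space \<Rightarrow> real"
  assumes "f differentiable (at x)"
  shows "GDERIV f x :> grad f x"
proof -
  obtain f' where f': "(f has_derivative f') (at x)"
    using assms by (auto simp: differentiable_def)
  then have "linear f'"
    by (rule has_derivative_linear)
  then have "f' = (\<lambda>h. inner h (adjoint f' 1))"
    using adjoint_works[of f' _ 1] by (auto simp: fun_eq_iff)
  with f' have "GDERIV f x :> adjoint f' 1"
    unfolding gderiv_def by simp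
  then show ?thesis
    using grad_eqI by metis
qed

definition KL :: "'a set \<Rightarrow> 'a pmf \<Rightarrow> 'a pmf \<Rightarrow> real" where
  "KL A P Q = (\<Sum>a\<in>A. pmf P a * ln (pmf P a / pmf Q a))"

text \<open>
  The library's divergence takes the base of the logarithm and the reference measure first.
\<close>

lemma KL_eq_KL_divergence:
  fixes P Q :: "'a::countable pmf"
  assumes "finite A" "set_pmf P \<subseteq> A" "set_pmf P \<subseteq> set_pmf Q"
  shows "KL A P Q = KL_divergence (exp 1) (measure_pmf Q) (measure_pmf P)"
proof -
  interpret sigma_finite_measure "count_space (UNIV :: 'a set)"
    by (rule sigma_finite_measure_count_space)
  have "KL_divergence (exp 1) (measure_pmf Q) (measure_pmf P) =
      KL_divergence (exp 1) (density (count_space UNIV) (pmf Q)) (density (count_space UNIV) (pmf P))"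
    by (simp only: measure_pmf_eq_density)
  also have "\<dots> = (\<integral>a. pmf P a * log (exp 1) (pmf P a / pmf Q a) \<partial>count_space UNIV)"
    using assms(3) by (intro KL_density_density) (auto simp: AE_count_space set_pmf_iff)
  also have "\<dots> = (\<Sum>a\<in>{a\<in>UNIV. pmf P a * ln (pmf P a / pmf Q a) \<noteq> 0}.
      pmf P a * ln (pmf P a / pmf Q a))"
    unfolding log_def using assms(1,2)
    by (subst lebesgue_integral_count_space_finite_support)
       (auto intro!: finite_subset[OF _ assms(1)] simp: set_pmf_iff)
  also have "\<dots> = KL A P Q"
    unfolding KL_def using assms(1,2)
    by (intro sum.mono_neutral_left) (auto simp: set_pmf_iff)
  finally show ?thesis ..
qed

text \<open>
  A policy maps a history \<open>(x, [y\<^sub>0, \<dots>, y\<^sub>n\<^sub>-\<^sub>1])\<close>, that is a prompt and the tokens generated so far,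
  to a next-token distribution.  For \<open>n < length y\<close> the history \<open>h\<^sub>n\<close> is \<open>(x, take n y)\<close>.
\<close>

type_synonym ('x, 'v) policy = "'x \<times> 'v list \<Rightarrow> 'v pmf"

definition seq_prob :: "('x, 'v) policy \<Rightarrow> 'x \<Rightarrow> 'v list \<Rightarrow> real" where
  "seq_prob p x y = (\<Prod>n<length y. pmf (p (x, take n y)) (y ! n))"

abbreviation seqs :: "nat \<Rightarrow> 'v list set" where
  "seqs L \<equiv> {y. length y = L}"

definition seq_pmf :: "nat \<Rightarrow> ('x, 'v::finite) policy \<Rightarrow> 'x \<Rightarrow> 'v list pmf" where
  "seq_pmf L p x = embed_pmf (\<lambda>y. if y \<in> seqs L then seq_prob p x y else 0)"

text \<open>
  \<^const>\<open>embed_pmf\<close> is only meaningful for a mass function of total mass 1; the following facts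
  show that this is the case here.
\<close>

lemma finite_seqs: "finite (seqs L :: 'v::finite list set)"
  using finite_lists_length_eq[of "UNIV :: 'v set" L] by simp

lemma seq_prob_nonneg: "seq_prob p x y \<ge> 0"
  by (simp add: seq_prob_def prod_nonneg)

lemma seq_prob_snoc: "seq_prob p x (y @ [a]) = seq_prob p x y * pmf (p (x, y)) a"
  by (simp add: seq_prob_def nth_append)

lemma sum_seq_prob: "(\<Sum>y\<in>seqs L. seq_prob p x (y :: 'v::finite list)) = 1"
proof (induction L)
  case 0
  then show ?case by (simp add: seq_prob_def)
next
  case (Suc L)
  have "bij_betw (\<lambda>(y, a). y @ [a]) (seqs L \<times> (UNIV :: 'v set)) (seqs (Suc L))"
    by (rule bij_betwI[where g = "\<lambda>y. (butlast y, last y)"])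
       (auto simp flip: length_greater_0_conv)
  then have "(\<Sum>y\<in>seqs (Suc L). seq_prob p x y) =
      (\<Sum>(y, a)\<in>seqs L \<times> UNIV. seq_prob p x (y @ [a]))"
    by (subst sum.reindex_bij_betw[symmetric]) (auto simp: case_prod_unfold)
  also have "\<dots> = (\<Sum>y\<in>seqs L. seq_prob p x y * (\<Sum>a\<in>UNIV. pmf (p (x, y)) a))"
    by (simp add: sum.cartesian_product[symmetric] seq_prob_snoc sum_distrib_left)
  also have "\<dots> = 1"
    using Suc.IH by (simp add: sum_pmf_eq_1)
  finally show ?case .
qed

lemma pmf_seq_pmf: "pmf (seq_pmf L p x) y = (if y \<in> seqs L then seq_prob p x y else 0)"
  unfolding seq_pmf_def
proof (rule pmf_embed_pmf)
  let ?f = "\<lambda>y. if y \<in> seqs L then seq_prob p x y else 0"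
  have "(\<integral>\<^sup>+y. ennreal (?f y) \<partial>count_space UNIV) = (\<Sum>y\<in>seqs L. ennreal (?f y))"
    by (rule nn_integral_count_space'[OF finite_seqs]) auto
  also have "\<dots> = ennreal (\<Sum>y\<in>seqs L. seq_prob p x y)"
    by (simp add: sum_ennreal seq_prob_nonneg)
  finally show "(\<integral>\<^sup>+y. ennreal (?f y) \<partial>count_space UNIV) = 1"
    by (simp add: sum_seq_prob)
qed (auto simp: seq_prob_nonneg)

definition log_ratio :: "('x, 'v) policy \<Rightarrow> ('x, 'v) policy \<Rightarrow> 'x \<Rightarrow> 'v list \<Rightarrow> nat \<Rightarrow> real" where
  "log_ratio p q x y n = ln (pmf (p (x, take n y)) (y ! n) / pmf (q (x, take n y)) (y ! n))"

definition score :: "('t::real_inner \<Rightarrow> ('x, 'v) policy) \<Rightarrow> 't \<Rightarrow> 'x \<Rightarrow> 'v list \<Rightarrow> nat \<Rightarrow> 't" where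
  "score \<pi> \<theta> x y n = grad (\<lambda>t. ln (pmf (\<pi> t (x, take n y)) (y ! n))) \<theta>"

end

theory Submission
  imports Defs
begin

text \<open>
  For any family of positive distributions the score has mean zero, so the gradient of the KL
  divergence is the mean of log-ratio times score; this applies both to single tokens and to whole
  sequences.  On sequences, log-ratio and score are sums over positions, and a cross term
  \<open>\<rho>\<^sub>m \<omega>\<^sub>n\<close> with \<open>m < n\<close> has mean zero because \<open>\<rho>\<^sub>m\<close> is determined by \<open>h\<^sub>n\<close>, given which
  \<open>\<omega>\<^sub>n\<close> has mean zero.
\<close>

lemma GDERIV_sum:
  assumes "\<And>i. i \<in> I \<Longrightarrow> GDERIV (f i) x :> D i"
  shows "GDERIV (\<lambda>t. \<Sum>i\<in>I. f i t) x :> (\<Sum>i\<in>I. D i)"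
  using assms unfolding gderiv_def inner_sum_right by (intro has_derivative_sum)

text \<open>Log-derivative trick: \<open>f\<close> is \<open>exp\<close> of its own logarithm
  because it is positive everywhere, so the chain rule applies. The lemmas below can therefore take
  scores as their only differentiability data.\<close>

lemma GDERIV_of_GDERIV_ln:
  assumes ln: "GDERIV (\<lambda>t. ln (f t)) x :> s" and pos: "\<And>t. f t > 0"
  shows "GDERIV f x :> f x *\<^sub>R s"
proof -
  have "GDERIV (\<lambda>t. exp (ln (f t))) x :> exp (ln (f x)) *\<^sub>R s"
    by (rule GDERIV_DERIV_compose[OF ln]) (rule DERIV_exp)
  then show ?thesis using pos by simp
qed

text \<open>The sum is the gradient of the total mass on \<open>A\<close>, which is constantly 1.
  Keeping \<open>A\<close> general covers both tokens (\<open>A = UNIV\<close>) and sequences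
  (\<open>A = seqs L\<close>).\<close>

lemma sum_pmf_scaleR_score_eq_0:
  fixes P :: "'t::real_inner \<Rightarrow> 'a pmf"
  assumes sum1: "\<And>t. (\<Sum>a\<in>A. pmf (P t) a) = 1"
    and pos: "\<And>t a. a \<in> A \<Longrightarrow> pmf (P t) a > 0"
    and s: "\<And>a. a \<in> A \<Longrightarrow> GDERIV (\<lambda>t. ln (pmf (P t) a)) \<theta> :> s a"
  shows "(\<Sum>a\<in>A. pmf (P \<theta>) a *\<^sub>R s a) = 0"
proof -
  have "GDERIV (\<lambda>t. \<Sum>a\<in>A. pmf (P t) a) \<theta> :> (\<Sum>a\<in>A. pmf (P \<theta>) a *\<^sub>R s a)"
    using pos s by (intro GDERIV_sum GDERIV_of_GDERIV_ln)
  then have "GDERIV (\<lambda>t. 1) \<theta> :> (\<Sum>a\<in>A. pmf (P \<theta>) a *\<^sub>R s a)"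
    by (simp only: sum1)
  then show ?thesis
    using GDERIV_const grad_eqI by metis
qed

lemma GDERIV_KL:
  fixes P :: "'t::real_inner \<Rightarrow> 'a pmf"
  assumes sum1: "\<And>t. (\<Sum>a\<in>A. pmf (P t) a) = 1"
    and pos: "\<And>t a. a \<in> A \<Longrightarrow> pmf (P t) a > 0"
    and Q: "\<And>a. a \<in> A \<Longrightarrow> pmf Q a > 0"
    and s: "\<And>a. a \<in> A \<Longrightarrow> GDERIV (\<lambda>t. ln (pmf (P t) a)) \<theta> :> s a"
  shows "GDERIV (\<lambda>t. KL A (P t) Q) \<theta> :>
    (\<Sum>a\<in>A. pmf (P \<theta>) a *\<^sub>R ln (pmf (P \<theta>) a / pmf Q a) *\<^sub>R s a)"
proof -
  have ln_ratio: "ln (pmf (P t) a / pmf Q a) = ln (pmf (P t) a) - ln (pmf Q a)" if "a \<in> A" for t a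
    using pos[OF that, of t] Q[OF that] by (simp add: ln_div)
  \<comment> \<open>Product rule: the first summand differentiates the logarithm, with 0 coming from
    the constant reference term, and adds up to the mean score. The second differentiates the weight
    and is the one that survives.\<close>
  have "GDERIV (\<lambda>t. \<Sum>a\<in>A. pmf (P t) a * (ln (pmf (P t) a) - ln (pmf Q a))) \<theta> :>
      (\<Sum>a\<in>A. pmf (P \<theta>) a *\<^sub>R (s a - 0) +
        (ln (pmf (P \<theta>) a) - ln (pmf Q a)) *\<^sub>R pmf (P \<theta>) a *\<^sub>R s a)"
    using pos s
    by (intro GDERIV_sum GDERIV_mult GDERIV_diff GDERIV_of_GDERIV_ln GDERIV_const)
  also have "(\<lambda>t. \<Sum>a\<in>A. pmf (P t) a * (ln (pmf (P t) a) - ln (pmf Q a))) = (\<lambda>t. KL A (P t) Q)"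
    by (simp add: KL_def ln_ratio)
  also have "(\<Sum>a\<in>A. pmf (P \<theta>) a *\<^sub>R (s a - 0) +
        (ln (pmf (P \<theta>) a) - ln (pmf Q a)) *\<^sub>R pmf (P \<theta>) a *\<^sub>R s a) =
      (\<Sum>a\<in>A. pmf (P \<theta>) a *\<^sub>R s a) +
        (\<Sum>a\<in>A. pmf (P \<theta>) a *\<^sub>R ln (pmf (P \<theta>) a / pmf Q a) *\<^sub>R s a)"
    by (simp add: sum.distrib ln_ratio mult.commute)
  also have "(\<Sum>a\<in>A. pmf (P \<theta>) a *\<^sub>R s a) = 0"
    using sum1 pos s by (rule sum_pmf_scaleR_score_eq_0)
  finally show ?thesis by simp
qed

lemma sum_seqs_Suc:
  fixes g :: "'v::finite list \<Rightarrow> 'b::real_vector"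
  shows "(\<Sum>y\<in>seqs (Suc n). seq_prob p x y *\<^sub>R g y) =
    (\<Sum>h\<in>seqs n. seq_prob p x h *\<^sub>R (\<Sum>a\<in>UNIV. pmf (p (x, h)) a *\<^sub>R g (h @ [a])))"
proof -
  have "bij_betw (\<lambda>(y, a). y @ [a]) (seqs n \<times> (UNIV :: 'v set)) (seqs (Suc n))"
    by (rule bij_betwI[where g = "\<lambda>y. (butlast y, last y)"])
       (auto simp flip: length_greater_0_conv)
  then have "(\<Sum>y\<in>seqs (Suc n). seq_prob p x y *\<^sub>R g y) =
      (\<Sum>(h, a)\<in>seqs n \<times> UNIV. seq_prob p x (h @ [a]) *\<^sub>R g (h @ [a]))"
    by (subst sum.reindex_bij_betw[symmetric]) (auto simp: case_prod_unfold)
  then show ?thesis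
    by (simp add: sum.cartesian_product[symmetric] seq_prob_snoc scaleR_sum_right)
qed

text \<open>Marginalization: tokens from position \<open>n\<close> on do not affect the integrand,
  so they are summed out one at a time from the end, each with conditional mass 1.\<close>

lemma sum_seqs_take:
  fixes g :: "'v::finite list \<Rightarrow> 'b::real_vector"
  assumes "n \<le> L"
  shows "(\<Sum>y\<in>seqs L. seq_prob p x y *\<^sub>R g (take n y)) = (\<Sum>h\<in>seqs n. seq_prob p x h *\<^sub>R g h)"
  using assms
proof (induction L rule: dec_induct)
  case base
  then show ?case by simp
next
  case (step L)
  then have "(\<Sum>y\<in>seqs (Suc L). seq_prob p x y *\<^sub>R g (take n y)) =
      (\<Sum>h\<in>seqs L. seq_prob p x h *\<^sub>R (\<Sum>a\<in>UNIV. pmf (p (x, h)) a *\<^sub>R g (take n h)))"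
    by (simp add: sum_seqs_Suc)
  also have "\<dots> = (\<Sum>h\<in>seqs L. seq_prob p x h *\<^sub>R g (take n h))"
    by (simp add: scaleR_sum_left[symmetric] sum_pmf_eq_1)
  finally show ?case using step.IH by simp
qed

text \<open>Tower property: \<open>sum_seqs_take\<close> shortens the left side to length
  \<open>Suc n\<close> and the right side to length \<open>n\<close>, and
  \<open>sum_seqs_Suc\<close> links the two. It serves to kill the cross terms and to prove the
  token-level identity.\<close>

lemma sum_seqs_condition_on_prefix:
  fixes g :: "'v::finite list \<Rightarrow> 'b::real_vector"
  assumes "n < L"
  shows "(\<Sum>y\<in>seqs L. seq_prob p x y *\<^sub>R g (take (Suc n) y)) =
    (\<Sum>y\<in>seqs L. seq_prob p x y *\<^sub>R
      (\<Sum>a\<in>UNIV. pmf (p (x, take n y)) a *\<^sub>R g (take n y @ [a])))"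
  using assms sum_seqs_take[of "Suc n" L p x g]
    sum_seqs_take[of n L p x "\<lambda>h. \<Sum>a\<in>UNIV. pmf (p (x, h)) a *\<^sub>R g (h @ [a])"]
  by (simp add: sum_seqs_Suc)

lemma expectation_seq_pmf:
  fixes f :: "'v::finite list \<Rightarrow> 'b::{banach, second_countable_topology}"
  shows "measure_pmf.expectation (seq_pmf L p x) f = (\<Sum>y\<in>seqs L. seq_prob p x y *\<^sub>R f y)"
  by (subst integral_measure_pmf[OF finite_seqs[of L]])
     (auto simp: set_pmf_iff pmf_seq_pmf split: if_splits)

text \<open>Locality: position \<open>m\<close> reads only the first \<open>m + 1\<close> tokens.
  This and its analogue for scores make prefix conditioning applicable.\<close>

lemma log_ratio_take:
  assumes "m < k"
  shows "log_ratio p q x (take k y) m = log_ratio p q x y m"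
  using assms by (simp add: log_ratio_def min_def)

lemma score_take:
  assumes "m < k"
  shows "score \<pi> \<theta> x (take k y) m = score \<pi> \<theta> x y m"
  using assms by (simp add: score_def min_def)

lemma log_ratio_append:
  assumes "m < length h"
  shows "log_ratio p q x (h @ z) m = log_ratio p q x h m"
  using assms by (simp add: log_ratio_def nth_append)

lemma ln_seq_prob_div:
  assumes "\<And>h a. length h < length y \<Longrightarrow> pmf (p (x, h)) a > 0"
    and "\<And>h a. length h < length y \<Longrightarrow> pmf (q (x, h)) a > 0"
  shows "ln (seq_prob p x y / seq_prob q x y) = (\<Sum>n<length y. log_ratio p q x y n)"
  unfolding seq_prob_def log_ratio_def prod_dividef[symmetric]
  using assms[THEN less_imp_neq] by (intro ln_prod) force+

theorem mainTheorem4: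
  fixes \<pi> :: "real ^ 'd \<Rightarrow> ('x, 'v::finite) policy"
    and \<pi>ref :: "('x, 'v) policy"
    and x :: 'x and L :: nat and \<theta> :: "real ^ 'd"
  assumes "L \<ge> 1"
    and "\<And>t h a. length h < L \<Longrightarrow> pmf (\<pi> t (x, h)) a > 0"
    and "\<And>h a. length h < L \<Longrightarrow> pmf (\<pi>ref (x, h)) a > 0"
    and "\<And>t h a. length h < L \<Longrightarrow> (\<lambda>s. pmf (\<pi> s (x, h)) a) differentiable (at t)"
  shows "GDERIV (\<lambda>t. KL (seqs L) (seq_pmf L (\<pi> t) x) (seq_pmf L \<pi>ref x)) \<theta> :>
      measure_pmf.expectation (seq_pmf L (\<pi> \<theta>) x)
        (\<lambda>y. \<Sum>n<L. (\<Sum>m=n..<L. log_ratio (\<pi> \<theta>) \<pi>ref x y m) *\<^sub>R score \<pi> \<theta> x y n) \<and>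
    measure_pmf.expectation (seq_pmf L (\<pi> \<theta>) x)
        (\<lambda>y. \<Sum>n<L. grad (\<lambda>t. KL UNIV (\<pi> t (x, take n y)) (\<pi>ref (x, take n y))) \<theta>) =
      measure_pmf.expectation (seq_pmf L (\<pi> \<theta>) x)
        (\<lambda>y. \<Sum>n<L. log_ratio (\<pi> \<theta>) \<pi>ref x y n *\<^sub>R score \<pi> \<theta> x y n)"
proof -
  note pos = assms(2) and ref_pos = assms(3) and diff = assms(4)
  let ?P = "seq_prob (\<pi> \<theta>) x" and ?\<rho> = "log_ratio (\<pi> \<theta>) \<pi>ref x" and ?\<omega> = "score \<pi> \<theta> x"

  \<comment> \<open>\<open>score\<close> expects a sequence and a position, so a history
    \<open>h\<close> with candidate next token \<open>a\<close> is encoded as \<open>h @ [a]\<close>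
    at position \<open>length h\<close>.\<close>
  have GDERIV_ln: "GDERIV (\<lambda>t. ln (pmf (\<pi> t (x, h)) a)) \<theta> :> ?\<omega> (h @ [a]) (length h)"
    if "length h < L" for h a
  proof -
    have "GDERIV (\<lambda>t. ln (pmf (\<pi> t (x, h)) a)) \<theta> :>
        inverse (pmf (\<pi> \<theta> (x, h)) a) *\<^sub>R grad (\<lambda>t. pmf (\<pi> t (x, h)) a) \<theta>"
      using that by (intro GDERIV_DERIV_compose[OF GDERIV_grad] DERIV_ln diff pos)
    then show ?thesis
      by (simp add: score_def grad_eqI)
  qed
  have GDERIV_ln_nth: "GDERIV (\<lambda>t. ln (pmf (\<pi> t (x, take n y)) (y ! n))) \<theta> :> ?\<omega> y n"
    if "n < L" "y \<in> seqs L" for y n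
    using GDERIV_ln[of "take n y" "y ! n"] that score_take[of n "Suc n" \<pi> \<theta> x y]
    by (simp add: take_Suc_conv_app_nth)
  have seq_prob_pos: "seq_prob (\<pi> t) x y > 0" "seq_prob \<pi>ref x y > 0" if "y \<in> seqs L" for t y
    using that pos ref_pos by (auto simp: seq_prob_def intro!: prod_pos)

  have GDERIV_ln_seq: "GDERIV (\<lambda>t. ln (pmf (seq_pmf L (\<pi> t) x) y)) \<theta> :> (\<Sum>n<L. ?\<omega> y n)"
    if y: "y \<in> seqs L" for y
  proof -
    have "ln (pmf (seq_pmf L (\<pi> t) x) y) = (\<Sum>n<L. ln (pmf (\<pi> t (x, take n y)) (y ! n)))" for t
      using y pos[THEN less_imp_neq] by (force simp: pmf_seq_pmf seq_prob_def intro!: ln_prod)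
    then show ?thesis
      using y by (auto intro!: GDERIV_sum GDERIV_ln_nth)
  qed

  have past_vanishes: "(\<Sum>y\<in>seqs L. ?P y *\<^sub>R (?\<rho> y m *\<^sub>R ?\<omega> y n)) = 0" if "m < n" "n < L" for m n
  proof -
    have "(\<Sum>y\<in>seqs L. ?P y *\<^sub>R (?\<rho> y m *\<^sub>R ?\<omega> y n)) =
        (\<Sum>y\<in>seqs L. ?P y *\<^sub>R (\<Sum>a\<in>UNIV. pmf (\<pi> \<theta> (x, take n y)) a *\<^sub>R
          (?\<rho> (take n y @ [a]) m *\<^sub>R ?\<omega> (take n y @ [a]) n)))"
      using that sum_seqs_condition_on_prefix[of n L "\<pi> \<theta>" x "\<lambda>z. ?\<rho> z m *\<^sub>R ?\<omega> z n"]
      by (simp add: log_ratio_take score_take)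
    also have "\<dots> = 0"
    proof (intro sum.neutral ballI)
      fix y :: "'v list" assume y: "y \<in> seqs L"
      have "(\<Sum>a\<in>UNIV. pmf (\<pi> \<theta> (x, take n y)) a *\<^sub>R ?\<omega> (take n y @ [a]) n) = 0"
        using that y GDERIV_ln[of "take n y"] pos
        by (intro sum_pmf_scaleR_score_eq_0[where P = "\<lambda>t. \<pi> t (x, take n y)"])
           (auto simp: sum_pmf_eq_1)
      \<comment> \<open>Since \<open>m < n\<close>, the log-ratio does not see the resampled token
        \<open>a\<close> and leaves the inner sum.\<close>
      moreover have "(\<Sum>a\<in>UNIV. pmf (\<pi> \<theta> (x, take n y)) a *\<^sub>R
            (?\<rho> (take n y @ [a]) m *\<^sub>R ?\<omega> (take n y @ [a]) n)) =
          ?\<rho> y m *\<^sub>R (\<Sum>a\<in>UNIV. pmf (\<pi> \<theta> (x, take n y)) a *\<^sub>R ?\<omega> (take n y @ [a]) n)"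
        using that y
        by (simp add: log_ratio_append log_ratio_take scaleR_sum_right mult.commute)
      ultimately show "?P y *\<^sub>R (\<Sum>a\<in>UNIV. pmf (\<pi> \<theta> (x, take n y)) a *\<^sub>R
          (?\<rho> (take n y @ [a]) m *\<^sub>R ?\<omega> (take n y @ [a]) n)) = 0"
        by simp
    qed
    finally show ?thesis .
  qed

  have "GDERIV (\<lambda>t. KL (seqs L) (seq_pmf L (\<pi> t) x) (seq_pmf L \<pi>ref x)) \<theta> :>
      (\<Sum>y\<in>seqs L. pmf (seq_pmf L (\<pi> \<theta>) x) y *\<^sub>R
        ln (pmf (seq_pmf L (\<pi> \<theta>) x) y / pmf (seq_pmf L \<pi>ref x) y) *\<^sub>R (\<Sum>n<L. ?\<omega> y n))"
    using seq_prob_pos GDERIV_ln_seq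
    by (intro GDERIV_KL) (auto simp: pmf_seq_pmf sum_seq_prob)
  also have "\<dots> = (\<Sum>y\<in>seqs L. ?P y *\<^sub>R (\<Sum>m<L. ?\<rho> y m) *\<^sub>R (\<Sum>n<L. ?\<omega> y n))"
    using pos ref_pos by (intro sum.cong) (auto simp: pmf_seq_pmf ln_seq_prob_div)
  also have "\<dots> = (\<Sum>y\<in>seqs L. \<Sum>n<L. \<Sum>m<L. ?P y *\<^sub>R (?\<rho> y m *\<^sub>R ?\<omega> y n))"
    by (simp only: scaleR_sum_left scaleR_sum_right)
  \<comment> \<open>The sum over \<open>y\<close> goes innermost because a cross term vanishes only
    on average, not for each \<open>y\<close>.\<close>
  also have "\<dots> = (\<Sum>n<L. \<Sum>m<L. \<Sum>y\<in>seqs L. ?P y *\<^sub>R (?\<rho> y m *\<^sub>R ?\<omega> y n))"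
    by (subst sum.swap) (intro sum.cong refl sum.swap)
  also have "\<dots> = (\<Sum>n<L. \<Sum>m=n..<L. \<Sum>y\<in>seqs L. ?P y *\<^sub>R (?\<rho> y m *\<^sub>R ?\<omega> y n))"
    by (intro sum.cong refl sum.mono_neutral_right ballI past_vanishes) auto
  also have "\<dots> = (\<Sum>y\<in>seqs L. \<Sum>n<L. \<Sum>m=n..<L. ?P y *\<^sub>R (?\<rho> y m *\<^sub>R ?\<omega> y n))"
    by (subst (2) sum.swap) (intro sum.cong refl sum.swap)
  also have "\<dots> = measure_pmf.expectation (seq_pmf L (\<pi> \<theta>) x)
      (\<lambda>y. \<Sum>n<L. (\<Sum>m=n..<L. ?\<rho> y m) *\<^sub>R ?\<omega> y n)"
    by (simp only: expectation_seq_pmf scaleR_sum_left scaleR_sum_right)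
  finally have sequence_level: "GDERIV (\<lambda>t. KL (seqs L) (seq_pmf L (\<pi> t) x) (seq_pmf L \<pi>ref x)) \<theta> :>
      measure_pmf.expectation (seq_pmf L (\<pi> \<theta>) x)
        (\<lambda>y. \<Sum>n<L. (\<Sum>m=n..<L. ?\<rho> y m) *\<^sub>R ?\<omega> y n)" .

  \<comment> \<open>With \<open>h\<close> held fixed, the gradient is the conditional mean of
    log-ratio times score over the next token. \<open>GDERIV_KL\<close> supplies the derivative that
    pins down \<open>grad\<close>.\<close>
  have grad_KL_token: "grad (\<lambda>t. KL UNIV (\<pi> t (x, h)) (\<pi>ref (x, h))) \<theta> =
      (\<Sum>a\<in>UNIV. pmf (\<pi> \<theta> (x, h)) a *\<^sub>R
        (?\<rho> (h @ [a]) (length h) *\<^sub>R ?\<omega> (h @ [a]) (length h)))"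
    if "length h < L" for h
  proof -
    have "GDERIV (\<lambda>t. KL UNIV (\<pi> t (x, h)) (\<pi>ref (x, h))) \<theta> :>
        (\<Sum>a\<in>UNIV. pmf (\<pi> \<theta> (x, h)) a *\<^sub>R
          ln (pmf (\<pi> \<theta> (x, h)) a / pmf (\<pi>ref (x, h)) a) *\<^sub>R ?\<omega> (h @ [a]) (length h))"
      using that pos ref_pos GDERIV_ln by (intro GDERIV_KL) (auto simp: sum_pmf_eq_1)
    then show ?thesis
      by (simp add: grad_eqI log_ratio_def)
  qed
  \<comment> \<open>Prefix conditioning read from right to left: averaging over prefixes turns the
    conditional mean over a fresh token \<open>a\<close> into the value at the sampled token
    \<open>y ! n\<close>.\<close>
  have token_level: "(\<Sum>y\<in>seqs L. ?P y *\<^sub>R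
        grad (\<lambda>t. KL UNIV (\<pi> t (x, take n y)) (\<pi>ref (x, take n y))) \<theta>) =
      (\<Sum>y\<in>seqs L. ?P y *\<^sub>R (?\<rho> y n *\<^sub>R ?\<omega> y n))"
    if "n < L" for n
    using that sum_seqs_condition_on_prefix[of n L "\<pi> \<theta>" x "\<lambda>z. ?\<rho> z n *\<^sub>R ?\<omega> z n"]
    by (simp add: grad_KL_token log_ratio_take score_take)
  have "measure_pmf.expectation (seq_pmf L (\<pi> \<theta>) x)
        (\<lambda>y. \<Sum>n<L. grad (\<lambda>t. KL UNIV (\<pi> t (x, take n y)) (\<pi>ref (x, take n y))) \<theta>) =
      measure_pmf.expectation (seq_pmf L (\<pi> \<theta>) x) (\<lambda>y. \<Sum>n<L. ?\<rho> y n *\<^sub>R ?\<omega> y n)"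
    unfolding expectation_seq_pmf scaleR_sum_right
    by (subst (1 2) sum.swap) (intro sum.cong refl token_level, simp)
  with sequence_level show ?thesis ..
qed

end
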